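(* Let $G$ be a non-abelian finite group and let $H$ be an abelian group of order $n$. Then the energies of the non-commuting graphs of $G\times H$ and $G$ satisfy $$E(\Gamma_{G\times H})=n\,E(\Gamma_{G}).$$
   Context: For a finite non-abelian group $G$ with center $Z(G)$, the non-commuting graph $\Gamma_G=\Gamma(G)$ is the simple graph with vertex set $G\setminus Z(G)$ in which two vertices $x,y$ are adjacent if and only if $xy\ne yx$. The energy of a graph $\Gamma$ is $E(\Gamma)=\sum_i|\lambda_i|$, where the $\lambda_i$ are the eigenvalues (with multiplicity) of its adjacency matrix. *)

theory Defs
  imports
    "HOL-Algebra.Coset"
    "Graph_Theory.Pair_Digraph"
    "Jordan_Normal_Form.Spectral_Radius"
begin

definition group_center :: "('a, 'm) monoid_scheme \<Rightarrow> 'a set" where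
  "group_center G =
     {z \<in> carrier G. \<forall>x \<in> carrier G. z \<otimes>\<^bsub>G\<^esub> x = x \<otimes>\<^bsub>G\<^esub> z}"

text \<open>A simple graph is a \<open>pair_graph\<close>: a finite, loop-free, symmetric digraph without
  parallel arcs, in which an edge is represented by its two opposite arcs.\<close>

definition non_commuting_graph :: "('a, 'm) monoid_scheme \<Rightarrow> 'a pair_pre_digraph" where
  "non_commuting_graph G =
     \<lparr> pverts = carrier G - group_center G,
       parcs = {(x, y). x \<in> carrier G - group_center G \<and> y \<in> carrier G - group_center G \<and>
                        x \<otimes>\<^bsub>G\<^esub> y \<noteq> y \<otimes>\<^bsub>G\<^esub> x} \<rparr>"

lemma pair_graph_non_commuting_graph:
  assumes "finite (carrier G)"
  shows "pair_graph (non_commuting_graph G)"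
proof
  have "parcs (non_commuting_graph G) \<subseteq> carrier G \<times> carrier G"
    by (auto simp: non_commuting_graph_def)
  then show "finite (parcs (non_commuting_graph G))"
    using assms by (meson finite_SigmaI finite_subset)
  show "symmetric (with_proj (non_commuting_graph G))"
    by (auto simp: symmetric_def sym_def non_commuting_graph_def)
qed (use assms in \<open>auto simp: non_commuting_graph_def\<close>)

text \<open>Adjacency matrix with respect to an enumeration \<open>vs\<close> of the vertices. The entries are
  taken in the complex numbers, so that the characteristic polynomial splits and every
  eigenvalue is counted without appealing to the spectral theorem.\<close>

definition adjacency_matrix :: "'a pair_pre_digraph \<Rightarrow> 'a list \<Rightarrow> complex mat" where
  "adjacency_matrix \<Gamma> vs =
     mat (length vs) (length vs) (\<lambda>(i, j). if (vs ! i, vs ! j) \<in> parcs \<Gamma> then 1 else 0)"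

text \<open>The multiplicity of an eigenvalue is its order as a root of the characteristic polynomial.
  The choice of the enumeration is irrelevant, see \<open>graph_energy_eq\<close> below.\<close>

definition matrix_energy :: "complex mat \<Rightarrow> real" where
  "matrix_energy A = (\<Sum>\<mu> \<in> spectrum A. real (Polynomial.order \<mu> (char_poly A)) * cmod \<mu>)"

definition graph_energy :: "'a pair_pre_digraph \<Rightarrow> real" where
  "graph_energy \<Gamma> =
     matrix_energy (adjacency_matrix \<Gamma> (SOME vs. distinct vs \<and> set vs = pverts \<Gamma>))"

lemma similar_adjacency_matrix:
  assumes vs: "distinct vs" and ws: "distinct ws" and eq: "set vs = set ws"
  shows "similar_mat (adjacency_matrix \<Gamma> vs) (adjacency_matrix \<Gamma> ws)"
proof -
  let ?n = "length vs"
  have len: "length ws = ?n" using vs ws eq by (metis distinct_card)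
  have "\<exists>k<?n. ws ! k = vs ! i" if "i < ?n" for i
    using that eq len by (metis in_set_conv_nth nth_mem)
  then obtain p where p: "\<And>i. i < ?n \<Longrightarrow> p i < ?n \<and> ws ! p i = vs ! i" by metis
  have inj: "inj_on p {..<?n}"
    using p vs by (metis (no_types, lifting) inj_onI lessThan_iff nth_eq_iff_index_eq)
  have surj: "\<exists>i<?n. p i = k" if "k < ?n" for k
  proof -
    have "p ` {..<?n} = {..<?n}"
      using inj p by (intro endo_inj_surj) auto
    then show ?thesis using that by (metis imageE lessThan_iff)
  qed
  define P :: "complex mat" where "P = mat ?n ?n (\<lambda>(i, k). if p i = k then 1 else 0)"
  define Q :: "complex mat" where "Q = mat ?n ?n (\<lambda>(k, i). if p i = k then 1 else 0)"
  let ?A = "adjacency_matrix \<Gamma> vs" and ?B = "adjacency_matrix \<Gamma> ws"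
  have [simp]: "P \<in> carrier_mat ?n ?n" "Q \<in> carrier_mat ?n ?n"
    "?A \<in> carrier_mat ?n ?n" "?B \<in> carrier_mat ?n ?n"
    by (auto simp: P_def Q_def adjacency_matrix_def len)
  have PM: "(P * M) $$ (i, j) = M $$ (p i, j)"
    if M: "M \<in> carrier_mat ?n ?n" and ij: "i < ?n" "j < ?n" for M i j
  proof -
    have "(P * M) $$ (i, j) = (\<Sum>k<?n. (if p i = k then 1 else 0) * M $$ (k, j))"
      using M ij by (simp add: P_def scalar_prod_def atLeast0LessThan)
    also have "\<dots> = (\<Sum>k<?n. if k = p i then M $$ (k, j) else 0)"
      by (intro sum.cong) auto
    finally show ?thesis using p[OF ij(1)] by simp
  qed
  have MQ: "(M * Q) $$ (i, j) = M $$ (i, p j)"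
    if M: "M \<in> carrier_mat ?n ?n" and ij: "i < ?n" "j < ?n" for M i j
  proof -
    have "(M * Q) $$ (i, j) = (\<Sum>k<?n. M $$ (i, k) * (if p j = k then 1 else 0))"
      using M ij by (simp add: Q_def scalar_prod_def atLeast0LessThan)
    also have "\<dots> = (\<Sum>k<?n. if k = p j then M $$ (i, k) else 0)"
      by (intro sum.cong) auto
    finally show ?thesis using p[OF ij(2)] by simp
  qed
  have PQ: "P * Q = 1\<^sub>m ?n"
  proof (rule eq_matI)
    fix i j assume "i < dim_row (1\<^sub>m ?n :: complex mat)" "j < dim_col (1\<^sub>m ?n :: complex mat)"
    then have ij: "i < ?n" "j < ?n" by auto
    then have "(P * Q) $$ (i, j) = Q $$ (p i, j)" by (intro PM) auto
    then show "(P * Q) $$ (i, j) = 1\<^sub>m ?n $$ (i, j)"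
      using ij p[of i] inj by (auto simp: Q_def inj_on_def)
  qed (auto simp: P_def Q_def)
  have QP: "Q * P = 1\<^sub>m ?n"
    using PQ by (rule mat_mult_left_right_inverse[rotated 2]) auto
  have "?A = P * ?B * Q"
  proof (rule eq_matI)
    fix i j assume "i < dim_row (P * ?B * Q)" "j < dim_col (P * ?B * Q)"
    then have ij: "i < ?n" "j < ?n" by (auto simp: P_def Q_def)
    have "(P * ?B * Q) $$ (i, j) = (P * ?B) $$ (i, p j)"
      using ij by (intro MQ mult_carrier_mat[of _ _ ?n]) auto
    also have "\<dots> = ?B $$ (p i, p j)" using ij p by (intro PM) auto
    finally show "?A $$ (i, j) = (P * ?B * Q) $$ (i, j)"
      using ij p by (simp add: adjacency_matrix_def len)
  qed (auto simp: P_def Q_def adjacency_matrix_def)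
  moreover have "{?A, ?B, P, Q} \<subseteq> carrier_mat ?n ?n" by simp
  ultimately show ?thesis
    using PQ QP similar_matI by blast
qed

lemma graph_energy_eq:
  assumes "distinct vs" and "set vs = pverts \<Gamma>"
  shows "graph_energy \<Gamma> = matrix_energy (adjacency_matrix \<Gamma> vs)"
proof -
  let ?ws = "SOME ws. distinct ws \<and> set ws = pverts \<Gamma>"
  have ws: "distinct ?ws \<and> set ?ws = pverts \<Gamma>"
    by (rule someI[of _ vs]) (use assms in simp)
  have "char_poly (adjacency_matrix \<Gamma> ?ws) = char_poly (adjacency_matrix \<Gamma> vs)"
    using ws assms by (intro char_poly_similar similar_adjacency_matrix) auto
  moreover have "spectrum (adjacency_matrix \<Gamma> us)
      = {\<mu>. poly (char_poly (adjacency_matrix \<Gamma> us)) \<mu> = 0}" for us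
    unfolding spectrum_def
    using eigenvalue_root_char_poly[of "adjacency_matrix \<Gamma> us" "length us"]
    by (auto simp: adjacency_matrix_def)
  ultimately show ?thesis
    by (simp add: graph_energy_def matrix_energy_def)
qed

end

theory Submission
  imports Defs "Jordan_Normal_Form.Jordan_Normal_Form_Existence"
begin

text \<open>Since \<open>Z(G \<times> H) = Z(G) \<times> H\<close>, the adjacency matrix of the product is \<open>A \<otimes> J\<close>, where \<open>A\<close>
  is that of \<open>G\<close> and \<open>J\<close> is the all-ones matrix of size \<open>n\<close>. It factors as \<open>P * Q\<close> with
  \<open>Q * P = n A\<close>, and \<open>P * Q\<close> and \<open>Q * P\<close> have the same nonzero eigenvalues with the same
  multiplicities.\<close>

text \<open>\<open>char_poly_matrix\<close> respects the block form, only negating the off-diagonal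
  blocks, and the determinant of a block triangular matrix depends on the diagonal blocks
  alone.\<close>

lemma char_poly_four_block_upper_right_zero:
  fixes A :: "'a :: idom mat"
  assumes A: "A \<in> carrier_mat n n" and C: "C \<in> carrier_mat m n" and D: "D \<in> carrier_mat m m"
  shows "char_poly (four_block_mat A (0\<^sub>m n m) C D) = char_poly A * char_poly D"
proof -
  let ?C = "map_mat (\<lambda>a. [:- a:]) C"
  have "char_poly_matrix (four_block_mat A (0\<^sub>m n m) C D)
      = four_block_mat (char_poly_matrix A) (0\<^sub>m n m) ?C (char_poly_matrix D)"
    using A C D by (intro eq_matI) (auto simp: char_poly_matrix_def)
  moreover have "det (four_block_mat (char_poly_matrix A) (0\<^sub>m n m) ?C (char_poly_matrix D))
      = det (char_poly_matrix A) * det (char_poly_matrix D)"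
    using A C D by (intro det_four_block_mat_upper_right_zero) auto
  ultimately show ?thesis by (simp add: char_poly_def)
qed

lemma char_poly_zero_mat: "char_poly (0\<^sub>m n n :: 'a :: idom mat) = [:0, 1:] ^ n"
proof -
  have "char_poly (0\<^sub>m n n :: 'a mat) = (\<Prod>a\<leftarrow>diag_mat (0\<^sub>m n n :: 'a mat). [:- a, 1:])"
    by (rule char_poly_upper_triangular[of _ n]) auto
  also have "diag_mat (0\<^sub>m n n :: 'a mat) = replicate n 0"
    by (auto simp: diag_mat_def list_eq_iff_nth_eq)
  finally show ?thesis by simp
qed

text \<open>Both sides are characteristic polynomials of block triangular matrices that are conjugate
  by the unipotent matrix with upper right block \<open>P\<close>.\<close>

lemma char_poly_mult_commute:
  fixes P Q :: "'a :: idom mat"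
  assumes P: "P \<in> carrier_mat n m" and Q: "Q \<in> carrier_mat m n"
  shows "char_poly (P * Q) * [:0, 1:] ^ m = [:0, 1:] ^ n * char_poly (Q * P)"
proof -
  let ?L = "four_block_mat (P * Q) (0\<^sub>m n m) Q (0\<^sub>m m m)"
  let ?R = "four_block_mat (0\<^sub>m n n) (0\<^sub>m n m) Q (Q * P)"
  let ?U = "four_block_mat (1\<^sub>m n) P (0\<^sub>m m n) (1\<^sub>m m)"
  let ?V = "four_block_mat (1\<^sub>m n) (- P) (0\<^sub>m m n) (1\<^sub>m m)"
  have [simp]: "- P + P = 0\<^sub>m n m" "P + - P = 0\<^sub>m n m" using P by auto
  have [simp]: "- (0\<^sub>m k k) = (0\<^sub>m k k :: 'a mat)" for k by auto
  have UV: "?U * ?V = 1\<^sub>m (n + m)"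
    using P by (subst mult_four_block_mat[of _ n n _ m _ m _ _ n _ m]) auto
  have VU: "?V * ?U = 1\<^sub>m (n + m)"
    using P by (subst mult_four_block_mat[of _ n n _ m _ m _ _ n _ m]) auto
  \<comment> \<open>\<open>?U * ?R\<close> and \<open>?L * ?U\<close> differ only in how the product
    of \<open>P\<close>, \<open>Q\<close>, \<open>P\<close> is bracketed, so associativity makes
    \<open>?U\<close> intertwine \<open>?L\<close> and \<open>?R\<close>.\<close>
  have UR: "?U * ?R = four_block_mat (P * Q) (P * (Q * P)) Q (Q * P)"
    using P Q by (subst mult_four_block_mat[of _ n n _ m _ m _ _ n _ m]) auto
  have LU: "?L * ?U = four_block_mat (P * Q) (P * Q * P) Q (Q * P)"
    using P Q by (subst mult_four_block_mat[of _ n n _ m _ m _ _ n _ m]) auto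
  have carr: "?L \<in> carrier_mat (n + m) (n + m)" "?R \<in> carrier_mat (n + m) (n + m)"
    "?U \<in> carrier_mat (n + m) (n + m)" "?V \<in> carrier_mat (n + m) (n + m)"
    using P Q by auto
  have "?L = ?L * ?U * ?V"
    by (simp only: assoc_mult_mat[OF carr(1,3,4)] UV right_mult_one_mat[OF carr(1)])
  also have "?L * ?U = ?U * ?R"
    unfolding UR LU using P Q by (simp add: assoc_mult_mat[of _ n m _ n _ m])
  finally have "similar_mat ?L ?R"
    using carr UV VU by (intro similar_matI[of ?L ?R ?U ?V "n + m"]) (simp_all only: insert_subset empty_subsetI)
  then have "char_poly ?L = char_poly ?R" by (rule char_poly_similar)
  then show ?thesis
    using P Q char_poly_four_block_upper_right_zero[of "P * Q" n Q m "0\<^sub>m m m"]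
      char_poly_four_block_upper_right_zero[of "0\<^sub>m n n" n Q m "Q * P"]
    by (simp add: char_poly_zero_mat)
qed

text \<open>The extra factors in \<open>char_poly_mult_commute\<close> are powers of
  \<open>[:0, 1:]\<close>, whose only possible root is 0, so they do not affect the order at \<mu>
  \<noteq> 0.\<close>

lemma order_char_poly_mult_commute:
  fixes P Q :: "'a :: idom mat"
  assumes P: "P \<in> carrier_mat n m" and Q: "Q \<in> carrier_mat m n" and "\<mu> \<noteq> 0"
  shows "Polynomial.order \<mu> (char_poly (P * Q)) = Polynomial.order \<mu> (char_poly (Q * P))"
proof -
  have [simp]: "char_poly (P * Q) \<noteq> 0" "char_poly (Q * P) \<noteq> 0"
    using P Q degree_monic_char_poly[of "P * Q" n] degree_monic_char_poly[of "Q * P" m] by auto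
  have "Polynomial.order \<mu> ([:0, 1:] ^ k) = 0" for k
    using \<open>\<mu> \<noteq> 0\<close> by (intro order_0I) simp
  then show ?thesis
    using arg_cong[OF char_poly_mult_commute[OF P Q], of "Polynomial.order \<mu>"]
    by (simp add: order_mult)
qed

text \<open>Enlarging the index set allows summing over the spectra of two matrices at once.\<close>

lemma matrix_energy_eq_sum:
  assumes A: "A \<in> carrier_mat n n" and "finite S" and "spectrum A - {0} \<subseteq> S"
  shows "matrix_energy A = (\<Sum>\<mu>\<in>S. real (Polynomial.order \<mu> (char_poly A)) * cmod \<mu>)"
proof -
  have "char_poly A \<noteq> 0" using degree_monic_char_poly[OF A] by auto
  then have "Polynomial.order \<mu> (char_poly A) = 0" if "\<mu> \<notin> spectrum A" for \<mu>
    using that eigenvalue_root_char_poly[OF A] by (auto simp: spectrum_def order_root)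
  then have "(\<Sum>\<mu>\<in>spectrum A \<union> S. real (Polynomial.order \<mu> (char_poly A)) * cmod \<mu>)
      = matrix_energy A"
    unfolding matrix_energy_def using card_finite_spectrum(1)[OF A] \<open>finite S\<close>
    by (intro sum.mono_neutral_right) auto
  \<comment> \<open>The only spectral value that \<open>S\<close> may miss is 0, and its summand
    vanishes because of the factor \<open>cmod \<mu>\<close>.\<close>
  moreover have "(\<Sum>\<mu>\<in>spectrum A \<union> S. real (Polynomial.order \<mu> (char_poly A)) * cmod \<mu>)
      = (\<Sum>\<mu>\<in>S. real (Polynomial.order \<mu> (char_poly A)) * cmod \<mu>)"
    using card_finite_spectrum(1)[OF A] assms(2,3) by (intro sum.mono_neutral_right) auto
  ultimately show ?thesis by simp
qed

text \<open>The two products may have different sizes and hence different multiplicities of the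
  eigenvalue 0, but 0 contributes nothing to the energy.\<close>

lemma matrix_energy_mult_commute:
  assumes P: "P \<in> carrier_mat n m" and Q: "Q \<in> carrier_mat m n"
  shows "matrix_energy (P * Q) = matrix_energy (Q * P)"
proof -
  let ?S = "spectrum (P * Q) \<union> spectrum (Q * P) - {0}"
  have PQ: "P * Q \<in> carrier_mat n n" and QP: "Q * P \<in> carrier_mat m m" using P Q by auto
  have fin: "finite ?S" using card_finite_spectrum(1)[OF PQ] card_finite_spectrum(1)[OF QP] by simp
  have "matrix_energy (P * Q)
      = (\<Sum>\<mu>\<in>?S. real (Polynomial.order \<mu> (char_poly (P * Q))) * cmod \<mu>)"
    using fin by (intro matrix_energy_eq_sum[OF PQ]) auto
  also have "\<dots> = (\<Sum>\<mu>\<in>?S. real (Polynomial.order \<mu> (char_poly (Q * P))) * cmod \<mu>)"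
    using order_char_poly_mult_commute[OF P Q] by (intro sum.cong) auto
  also have "\<dots> = matrix_energy (Q * P)"
    using fin by (intro matrix_energy_eq_sum[OF QP, symmetric]) auto
  finally show ?thesis .
qed

text \<open>Since \<open>k\<close> is nonzero, \<mu> is a root for
  \<open>k \<cdot>\<^sub>m A\<close> to the same order as \<mu> / k is for \<open>A\<close>, so
  every eigenvalue keeps its multiplicity and is stretched by \<open>k\<close>.\<close>

lemma matrix_energy_smult:
  assumes A: "A \<in> carrier_mat n n" and k: "k \<noteq> 0"
  shows "matrix_energy (k \<cdot>\<^sub>m A) = cmod k * matrix_energy A"
proof -
  \<comment> \<open>This set contains the spectrum of \<open>k \<cdot>\<^sub>m A\<close>, and its
    image under division by \<open>k\<close> contains that of \<open>A\<close>, so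
    \<open>matrix_energy_eq_sum\<close> applies before and after reindexing.\<close>
  let ?S = "spectrum (k \<cdot>\<^sub>m A) \<union> (*) k ` spectrum A"
  let ?f = "\<lambda>\<mu>. real (Polynomial.order \<mu> (char_poly A)) * cmod \<mu>"
  have kA: "k \<cdot>\<^sub>m A \<in> carrier_mat n n" using A by simp
  have fin: "finite ?S" using card_finite_spectrum(1)[OF A] card_finite_spectrum(1)[OF kA] by simp
  have "matrix_energy (k \<cdot>\<^sub>m A)
      = (\<Sum>\<mu>\<in>?S. real (Polynomial.order \<mu> (char_poly (k \<cdot>\<^sub>m A))) * cmod \<mu>)"
    using fin by (intro matrix_energy_eq_sum[OF kA]) auto
  also have "\<dots> = (\<Sum>\<mu>\<in>?S. cmod k * ?f (\<mu> / k))"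
    using k order_char_poly_smult[OF A k] by (intro sum.cong) (auto simp: norm_divide)
  also have "\<dots> = (\<Sum>\<mu>\<in>(\<lambda>\<mu>. \<mu> / k) ` ?S. cmod k * ?f \<mu>)"
    using k by (subst sum.reindex) (auto simp: inj_on_def)
  also have "\<dots> = cmod k * matrix_energy A"
    unfolding sum_distrib_left[symmetric] using k fin card_finite_spectrum(1)[OF A]
    by (subst matrix_energy_eq_sum[OF A, of "(\<lambda>\<mu>. \<mu> / k) ` ?S"])
      (auto simp: image_Un image_image)
  finally show ?thesis .
qed

text \<open>For n > 0 the indices with quotient \<open>i\<close> form an interval of length
  \<open>n\<close>, which lies below \<open>m * n\<close> because i < m.\<close>

lemma sum_if_div_eq:
  fixes c :: "'a :: semiring_1"
  assumes "i < m"
  shows "(\<Sum>a<m * n. if a div n = i then c else 0) = of_nat n * c"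
proof (cases "n = 0")
  case False
  have "{..<m * n} \<inter> {a. a div n = i} = {i * n..<Suc i * n}"
  proof (intro equalityI subsetI)
    fix a assume "a \<in> {..<m * n} \<inter> {a. a div n = i}"
    then have "i \<le> a div n" "a div n < Suc i" by auto
    then have "i * n \<le> a" "a < Suc i * n"
      using False by (simp_all only: less_eq_div_iff_mult_less_eq div_less_iff_less_mult neq0_conv)
    then show "a \<in> {i * n..<Suc i * n}" by (simp only: atLeastLessThan_iff)
  next
    fix a assume "a \<in> {i * n..<Suc i * n}"
    then have "i * n \<le> a" and a: "a < Suc i * n" by (simp_all only: atLeastLessThan_iff)
    then have "i \<le> a div n" "a div n < Suc i"
      using False by (simp_all only: less_eq_div_iff_mult_less_eq div_less_iff_less_mult neq0_conv)
    moreover have "Suc i * n \<le> m * n" using assms by (intro mult_le_mono1) (rule Suc_leI)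
    ultimately show "a \<in> {..<m * n} \<inter> {a. a div n = i}" using less_le_trans[OF a] by auto
  qed
  then show ?thesis by (simp add: sum.If_cases)
qed simp

lemma matrix_energy_blow_up:
  assumes A: "A \<in> carrier_mat m m" and n: "n > 0"
  shows "matrix_energy (mat (m * n) (m * n) (\<lambda>(a, b). A $$ (a div n, b div n)))
    = real n * matrix_energy A"
proof -
  \<comment> \<open>\<open>P\<close> lists each row of \<open>A\<close> n times. Multiplying by
    \<open>Q\<close> on the right repeats each column n times, while multiplying by \<open>Q\<close>
    on the left adds up the n equal rows of each block.\<close>
  define P where "P = mat (m * n) m (\<lambda>(a, j). A $$ (a div n, j))"
  define Q :: "complex mat" where "Q = mat m (m * n) (\<lambda>(i, a). if a div n = i then 1 else 0)"
  have P: "P \<in> carrier_mat (m * n) m" and Q: "Q \<in> carrier_mat m (m * n)"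
    by (simp_all add: P_def Q_def)
  have less: "a div n < m" if "a < m * n" for a
    using that n by (simp add: div_less_iff_less_mult)
  have "mat (m * n) (m * n) (\<lambda>(a, b). A $$ (a div n, b div n)) = P * Q"
  proof (rule eq_matI)
    fix a b assume "a < dim_row (P * Q)" and "b < dim_col (P * Q)"
    then have ab: "a < m * n" "b < m * n" using P Q by auto
    then have "(P * Q) $$ (a, b) = (\<Sum>i<m. A $$ (a div n, i) * (if b div n = i then 1 else 0))"
      by (simp add: P_def Q_def scalar_prod_def atLeast0LessThan)
    also have "\<dots> = A $$ (a div n, b div n)"
      using less[OF ab(2)] by (simp add: if_distrib[of "(*) _"] cong: if_cong)
    finally show "mat (m * n) (m * n) (\<lambda>(a, b). A $$ (a div n, b div n)) $$ (a, b) = (P * Q) $$ (a, b)"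
      using ab by simp
  qed (use P Q in auto)
  then have "matrix_energy (mat (m * n) (m * n) (\<lambda>(a, b). A $$ (a div n, b div n)))
      = matrix_energy (Q * P)"
    using matrix_energy_mult_commute[OF P Q] by simp
  also have "Q * P = of_nat n \<cdot>\<^sub>m A"
  proof (rule eq_matI)
    fix i j assume "i < dim_row (of_nat n \<cdot>\<^sub>m A)" and "j < dim_col (of_nat n \<cdot>\<^sub>m A)"
    then have ij: "i < m" "j < m" using A by auto
    then have "(Q * P) $$ (i, j)
        = (\<Sum>a<m * n. (if a div n = i then 1 else 0) * A $$ (a div n, j))"
      by (simp add: P_def Q_def scalar_prod_def atLeast0LessThan)
    also have "\<dots> = (\<Sum>a<m * n. if a div n = i then A $$ (i, j) else 0)"
      by (intro sum.cong) auto
    also have "\<dots> = (of_nat n \<cdot>\<^sub>m A) $$ (i, j)"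
      using A ij by (simp add: sum_if_div_eq)
    finally show "(Q * P) $$ (i, j) = (of_nat n \<cdot>\<^sub>m A) $$ (i, j)" .
  qed (use A P Q in auto)
  finally show ?thesis
    using n by (simp add: matrix_energy_smult[OF A])
qed

text \<open>Testing a central pair against pairs (x, 1) shows that its first component is central;
  commutativity of \<open>H\<close> gives the converse.\<close>

lemma group_center_DirProd:
  assumes "group G" and "comm_group H"
  shows "group_center (G \<times>\<times> H) = group_center G \<times> carrier H"
proof -
  interpret G: group G by fact
  interpret H: comm_group H by fact
  show ?thesis
    using H.m_comm H.one_closed by (fastforce simp: group_center_def)
qed

text \<open>As \<open>H\<close> is commutative, first components alone decide whether pairs commute:
  each vertex of the graph of \<open>G\<close> is replaced by mutually non-adjacent copies indexed
  by \<open>H\<close>.\<close>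

lemma non_commuting_graph_DirProd:
  assumes "group G" and "comm_group H"
  shows "pverts (non_commuting_graph (G \<times>\<times> H)) = pverts (non_commuting_graph G) \<times> carrier H"
    and "((g, h), (g', h')) \<in> parcs (non_commuting_graph (G \<times>\<times> H)) \<longleftrightarrow>
      (g, g') \<in> parcs (non_commuting_graph G) \<and> h \<in> carrier H \<and> h' \<in> carrier H"
proof -
  interpret H: comm_group H by fact
  show "pverts (non_commuting_graph (G \<times>\<times> H)) = pverts (non_commuting_graph G) \<times> carrier H"
    by (auto simp: non_commuting_graph_def group_center_DirProd[OF assms])
  show "((g, h), (g', h')) \<in> parcs (non_commuting_graph (G \<times>\<times> H)) \<longleftrightarrow>
      (g, g') \<in> parcs (non_commuting_graph G) \<and> h \<in> carrier H \<and> h' \<in> carrier H"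
    using H.m_comm[of h h'] by (auto simp: non_commuting_graph_def group_center_DirProd[OF assms])
qed

theorem theorem3p1:
  fixes G :: "('a, 'm) monoid_scheme" and H :: "('b, 'k) monoid_scheme" and n :: nat
  assumes "group G" and "finite (carrier G)" and "\<not> comm_group G"
    and "comm_group H" and "finite (carrier H)" and "Coset.order H = n"
  shows "graph_energy (non_commuting_graph (G \<times>\<times> H)) =
           real n * graph_energy (non_commuting_graph G)"
proof -
  interpret H: comm_group H by fact
  let ?\<Gamma> = "non_commuting_graph G" and ?\<Delta> = "non_commuting_graph (G \<times>\<times> H)"
  have "finite (pverts ?\<Gamma>)" using assms(2) by (simp add: non_commuting_graph_def)
  then obtain vs where vs: "distinct vs" "set vs = pverts ?\<Gamma>"
    using finite_distinct_list by blast
  obtain hs where hs: "distinct hs" "set hs = carrier H"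
    using finite_distinct_list[OF assms(5)] by blast
  have len: "length hs = n"
    using hs assms(6) by (metis distinct_card Coset.order_def)
  have n: "n > 0" using len hs H.one_closed by (metis length_pos_if_in_set)
  \<comment> \<open>In \<open>List.product\<close> the first component varies slowest: position
    \<open>a\<close> holds \<open>(vs ! (a div n), hs ! (a mod n))\<close>, which gives the index
    pattern of \<open>matrix_energy_blow_up\<close>.\<close>
  let ?ws = "List.product vs hs" and ?A = "adjacency_matrix ?\<Gamma> vs"
  have "adjacency_matrix ?\<Delta> ?ws
      = mat (length vs * n) (length vs * n) (\<lambda>(a, b). ?A $$ (a div n, b div n))"
    using n hs len nth_mem[of _ hs]
    by (intro eq_matI) (auto simp: adjacency_matrix_def product_nth div_less_iff_less_mult
        non_commuting_graph_DirProd[OF assms(1,4)])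
  moreover have "?A \<in> carrier_mat (length vs) (length vs)"
    by (simp add: adjacency_matrix_def)
  ultimately have "matrix_energy (adjacency_matrix ?\<Delta> ?ws) = real n * matrix_energy ?A"
    using n by (simp add: matrix_energy_blow_up)
  \<comment> \<open>This lets \<open>graph_energy_eq\<close> replace the arbitrarily chosen
    enumeration by \<open>?ws\<close>.\<close>
  moreover have "distinct ?ws" and "set ?ws = pverts ?\<Delta>"
    using vs hs by (auto simp: distinct_product non_commuting_graph_DirProd[OF assms(1,4)])
  ultimately show ?thesis
    using vs by (simp add: graph_energy_eq)
qed

end
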